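(* For every integer $n>2$, the abstract group $\mathbb Z/n\mathbb Z$ is minimally generated in codimension two.
   Context: All representations are finite-dimensional and real. For $g\in GL(V)$ of finite order, $V^{\langle g\rangle}$ is the subspace of vectors fixed by $g$. A finite subgroup $G\subset GL(V)$ is strictly generated in codimension $k$ if it is generated by its elements $g$ with $\operatorname{codim}V^{\langle g\rangle}=k$. A finite abstract group $\Gamma$ is minimally generated in codimension $k$ if $k$ is the minimal integer for which there exists a faithful real representation $\rho:\Gamma\to GL(V)$ such that $\rho(\Gamma)$ is strictly generated in codimension $k$. *)

theory Defs
  imports
    "HOL-Algebra.Elementary_Groups"
    "HOL-Algebra.Generated_Groups"
    "Jordan_Normal_Form.Matrix_Kernel"
begin

text \<open>A finite-dimensional real vector space is represented by the coordinate space of real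
  column vectors of length \<open>d\<close>, for arbitrary \<open>d\<close> (including \<open>d = 0\<close>), and \<open>GL(V)\<close> by the
  invertible real \<open>d \<times> d\<close> matrices.\<close>

definition real_GL :: "nat \<Rightarrow> real mat monoid" where
  "real_GL d = units_of (ring_mat TYPE(real) d ())"

definition fixed_space :: "nat \<Rightarrow> real mat \<Rightarrow> (real, real vec) module" where
  "fixed_space d A =
     (module_vec TYPE(real) d)\<lparr>carrier := {v \<in> carrier_vec d. A *\<^sub>v v = v}\<rparr>"

text \<open>The subtraction never truncates: the fixed space has dimension at most \<open>d\<close>.\<close>

definition fixed_codim :: "nat \<Rightarrow> real mat \<Rightarrow> nat" where
  "fixed_codim d A = d - vectorspace.dim class_ring (fixed_space d A)"

definition strictly_generated_in_codim :: "nat \<Rightarrow> real mat set \<Rightarrow> nat \<Rightarrow> bool" where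
  "strictly_generated_in_codim d G k \<longleftrightarrow>
     finite G \<and> subgroup G (real_GL d) \<and>
     generate (real_GL d) {A \<in> G. fixed_codim d A = k} = G"

definition faithful_real_rep ::
    "('a, 'b) monoid_scheme \<Rightarrow> nat \<Rightarrow> ('a \<Rightarrow> real mat) \<Rightarrow> bool" where
  "faithful_real_rep \<Gamma> d \<rho> \<longleftrightarrow> \<rho> \<in> hom \<Gamma> (real_GL d) \<and> inj_on \<rho> (carrier \<Gamma>)"

definition has_rep_generated_in_codim :: "('a, 'b) monoid_scheme \<Rightarrow> nat \<Rightarrow> bool" where
  "has_rep_generated_in_codim \<Gamma> k \<longleftrightarrow>
     (\<exists>d \<rho>. faithful_real_rep \<Gamma> d \<rho> \<and> strictly_generated_in_codim d (\<rho> ` carrier \<Gamma>) k)"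

definition minimally_generated_in_codim :: "('a, 'b) monoid_scheme \<Rightarrow> nat \<Rightarrow> bool" where
  "minimally_generated_in_codim \<Gamma> k \<longleftrightarrow>
     group \<Gamma> \<and> finite (carrier \<Gamma>) \<and>
     has_rep_generated_in_codim \<Gamma> k \<and>
     (\<forall>j. has_rep_generated_in_codim \<Gamma> j \<longrightarrow> k \<le> j)"

lemma group_real_GL: "group (real_GL d)"
proof -
  interpret ring "ring_mat TYPE(real) d ()" by (rule ring_mat)
  show ?thesis unfolding real_GL_def by (rule units_group)
qed

lemma real_GL_simps:
  "carrier (real_GL d) =
     {A \<in> carrier_mat d d. \<exists>B \<in> carrier_mat d d. B * A = 1\<^sub>m d \<and> A * B = 1\<^sub>m d}"
  "A \<otimes>\<^bsub>real_GL d\<^esub> B = A * B"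
  "\<one>\<^bsub>real_GL d\<^esub> = 1\<^sub>m d"
  by (auto simp: real_GL_def units_of_def Units_def ring_mat_simps)

lemma fixed_space_eq_kernel:
  assumes "A \<in> carrier_mat d d"
  shows "fixed_space d A =
    (module_vec TYPE(real) d)\<lparr>carrier := mat_kernel (A - 1\<^sub>m d)\<rparr>"
proof -
  have "A *\<^sub>v v = v \<longleftrightarrow> (A - 1\<^sub>m d) *\<^sub>v v = 0\<^sub>v d" if v: "v \<in> carrier_vec d" for v
  proof -
    have "(A - 1\<^sub>m d) *\<^sub>v v = A *\<^sub>v v - v"
      using assms v by (simp add: minus_mult_distrib_mat_vec)
    moreover have "A *\<^sub>v v - v = 0\<^sub>v d \<longleftrightarrow> A *\<^sub>v v = v"
      using assms v by (auto simp: vec_eq_iff)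
    ultimately show ?thesis by simp
  qed
  then have "{v \<in> carrier_vec d. A *\<^sub>v v = v} = mat_kernel (A - 1\<^sub>m d)"
    using assms by (auto simp: mat_kernel_def)
  then show ?thesis by (simp add: fixed_space_def)
qed

lemma vectorspace_fixed_space:
  assumes "A \<in> carrier_mat d d"
  shows "vectorspace class_ring (fixed_space d A)"
proof -
  interpret kernel d d "A - 1\<^sub>m d" using assms by unfold_locales auto
  show ?thesis
    using Ker.vectorspace_axioms assms by (simp add: fixed_space_eq_kernel)
qed

end

(* The rotation by 2 pi / n of the plane fixes only the origin, which gives codimension 2.
   Conversely, let A have finite order n and fixed space of codimension at most 1. Then N = A - 1
   has rank at most 1, so N^2 = c N for some real c and A^k = 1 + (1 + l + ... + l^(k-1)) N with
   l = 1 + c. From A^n = 1 either N = 0 or the geometric sum vanishes, which over the reals forces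
   l = -1; in both cases A^2 = 1. So a cyclic group generated in codimension at most 1 has
   exponent 2, hence order at most 2. *)
theory Submission
  imports Defs
begin

section \<open>Square matrices of rank at most one\<close>

lemma mat_eqI_mult_vec:
  fixes A B :: "'a :: comm_ring_1 mat"
  assumes A: "A \<in> carrier_mat nr nc" and B: "B \<in> carrier_mat nr nc"
    and eq: "\<And>v. v \<in> carrier_vec nc \<Longrightarrow> A *\<^sub>v v = B *\<^sub>v v"
  shows "A = B"
proof (rule eq_matI)
  fix i j assume "i < dim_row B" "j < dim_col B"
  then have ij: "i < nr" "j < nc" using B by auto
  then have "(A *\<^sub>v unit_vec nc j) $ i = (B *\<^sub>v unit_vec nc j) $ i" using eq by simp
  then show "A $$ (i, j) = B $$ (i, j)" using ij A B by simp
qed (use A B in auto)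

lemma smult_mat_mult_vec:
  fixes A :: "'a :: comm_ring_1 mat"
  assumes "A \<in> carrier_mat nr nc" "v \<in> carrier_vec nc"
  shows "(c \<cdot>\<^sub>m A) *\<^sub>v v = c \<cdot>\<^sub>v (A *\<^sub>v v)"
  using assms by (intro eq_vecI) auto

text \<open>The image of \<open>N\<close> is spanned by a single vector \<open>N v\<close>. Since
  \<open>N\<close> maps this span into itself, it acts there as a scalar, and that scalar is
  \<open>c\<close>.\<close>

lemma square_eq_smult_if_corank_le_1:
  fixes N :: "'a :: field mat"
  assumes N: "N \<in> carrier_mat d d" and corank: "d \<le> Suc (kernel_dim N)"
  obtains c where "N * N = c \<cdot>\<^sub>m N"
proof -
  interpret kernel d d N by unfold_locales (rule N)
  obtain B where finB: "finite B" and basis: "Ker.basis B"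
    using kernel_basis_exists[OF N] by blast
  have Bker: "B \<subseteq> mat_kernel N" and BV: "B \<subseteq> carrier_vec d"
    using basis mat_kernel_carrier[OF N] by (auto simp: Ker.basis_def)
  have span: "NC.span B = mat_kernel N" and li: "\<not> NC.lin_dep B"
    using basis span_same[OF Bker] lindep_same[OF Bker] by (auto simp: Ker.basis_def)
  have card: "d \<le> Suc (card B)"
    using corank Ker.dim_basis[OF finB basis] by simp
  show thesis
  proof (cases "mat_kernel N = carrier_vec d")
    case True
    \<comment> \<open>Here \<open>N\<close> is the zero matrix, so 0 serves as the scalar.\<close>
    have "N * N = 0 \<cdot>\<^sub>m N"
    proof (rule mat_eqI_mult_vec)
      fix v :: "'a vec" assume v: "v \<in> carrier_vec d"
      then have "N *\<^sub>v v = 0\<^sub>v d" using True N by (auto simp: mat_kernel)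
      then show "N * N *\<^sub>v v = 0 \<cdot>\<^sub>m N *\<^sub>v v"
        using v N by (auto simp: smult_mat_mult_vec[of _ d d])
    qed (use N in auto)
    then show thesis by (rule that)
  next
    case False
    then obtain v where v: "v \<in> carrier_vec d" "v \<notin> NC.span B"
      using mat_kernel_carrier[OF N] span by blast
    have vB: "v \<notin> B" using v(2) BV NC.span_mem by auto
    have "\<not> NC.lin_dep (B \<union> {v})"
      using NC.lin_dep_iff_in_span[of B v] BV li v vB by auto
    \<comment> \<open>\<open>B\<close> has at least \<open>d\<close> - 1 elements, so adding
      \<open>v\<close> gives at least \<open>d\<close> independent vectors in a space of dimension
      \<open>d\<close>.\<close>
    then have "NC.basis (B \<union> {v})"
      using finB BV v(1) vB card
      by (intro NC.dim_li_is_basis) (auto simp: NC.dim_is_n)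
    then have gen: "NC.span (B \<union> {v}) = carrier_vec d"
      by (simp add: NC.basis_def)
    \<comment> \<open>Modulo the kernel every vector is a multiple of \<open>v\<close>; applying
      \<open>N\<close> kills the kernel part.\<close>
    have mult: "\<exists>a. N *\<^sub>v x = a \<cdot>\<^sub>v (N *\<^sub>v v)" if x: "x \<in> carrier_vec d" for x
    proof -
      obtain a where a: "NC.lincomb a (B \<union> {v}) = x"
        using NC.finite_in_span[of "B \<union> {v}" x] finB BV v(1) x gen by auto
      have x_eq: "x = a v \<cdot>\<^sub>v v + NC.lincomb a B"
        using NC.lincomb_insert[OF finB, where a = a and v = v] BV v(1) vB a by auto
      have "NC.lincomb a B \<in> mat_kernel N"
        using finB unfolding span[symmetric] NC.span_def by auto
      then have w: "NC.lincomb a B \<in> carrier_vec d" "N *\<^sub>v NC.lincomb a B = 0\<^sub>v d"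
        using N by (auto simp: mat_kernel)
      have "N *\<^sub>v x = a v \<cdot>\<^sub>v (N *\<^sub>v v)"
        using w N v(1)
        by (simp add: x_eq mult_add_distrib_mat_vec[of _ d d] mult_mat_vec[of _ d d])
      then show ?thesis by blast
    qed
    obtain c where c: "N *\<^sub>v (N *\<^sub>v v) = c \<cdot>\<^sub>v (N *\<^sub>v v)"
      using mult[of "N *\<^sub>v v"] N v by auto
    have "N * N = c \<cdot>\<^sub>m N"
    proof (rule mat_eqI_mult_vec)
      fix x :: "'a vec" assume x: "x \<in> carrier_vec d"
      obtain a where a: "N *\<^sub>v x = a \<cdot>\<^sub>v (N *\<^sub>v v)" using mult[OF x] by blast
      have "N * N *\<^sub>v x = a \<cdot>\<^sub>v (N *\<^sub>v (N *\<^sub>v v))"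
        using x N v by (simp add: a mult_mat_vec[of _ d d])
      also have "\<dots> = c \<cdot>\<^sub>v (N *\<^sub>v x)"
        by (simp add: a c smult_smult_assoc mult.commute)
      finally show "N * N *\<^sub>v x = c \<cdot>\<^sub>m N *\<^sub>v x"
        using x N by (simp add: smult_mat_mult_vec[of _ d d])
    qed (use N in auto)
    then show thesis by (rule that)
  qed
qed

section \<open>Powers of \<open>1 + N\<close> and matrices of finite order\<close>

lemma pow_one_add_mat:
  fixes N :: "'a :: comm_ring_1 mat"
  assumes N: "N \<in> carrier_mat d d" and NN: "N * N = c \<cdot>\<^sub>m N"
  shows "(1\<^sub>m d + N) ^\<^sub>m k = 1\<^sub>m d + (\<Sum>i<k. (1 + c) ^ i) \<cdot>\<^sub>m N"
proof (induction k)
  case 0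
  then show ?case using N by (auto intro!: eq_matI)
next
  case (Suc k)
  let ?s = "\<Sum>i<k. (1 + c) ^ i"
  have sN: "?s \<cdot>\<^sub>m N \<in> carrier_mat d d" using N by simp
  have "(1\<^sub>m d + N) ^\<^sub>m Suc k = (1\<^sub>m d + ?s \<cdot>\<^sub>m N) * (1\<^sub>m d + N)"
    by (simp add: Suc)
  also have "\<dots> = 1\<^sub>m d * (1\<^sub>m d + N) + ?s \<cdot>\<^sub>m N * (1\<^sub>m d + N)"
    using N sN by (intro add_mult_distrib_mat) auto
  also have "?s \<cdot>\<^sub>m N * (1\<^sub>m d + N) = ?s \<cdot>\<^sub>m N * 1\<^sub>m d + ?s \<cdot>\<^sub>m N * N"
    using N sN by (intro mult_add_distrib_mat) auto
  also have "?s \<cdot>\<^sub>m N * N = ?s \<cdot>\<^sub>m (c \<cdot>\<^sub>m N)"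
    using mult_smult_assoc_mat[OF N N] by (simp add: NN)
  also have "1\<^sub>m d * (1\<^sub>m d + N) + (?s \<cdot>\<^sub>m N * 1\<^sub>m d + ?s \<cdot>\<^sub>m (c \<cdot>\<^sub>m N)) =
      1\<^sub>m d + N + (?s \<cdot>\<^sub>m N + ?s \<cdot>\<^sub>m (c \<cdot>\<^sub>m N))"
    using N sN by simp
  also have "\<dots> = 1\<^sub>m d + (1 + (1 + c) * ?s) \<cdot>\<^sub>m N"
    using N by (intro eq_matI) (auto simp: algebra_simps)
  \<comment> \<open>Multiplying the sum by its ratio raises every exponent by one, so the new
    summand 1 is the term \<open>i = 0\<close>; hence the sum is split at its first term, not its
    last.\<close>
  also have "1 + (1 + c) * ?s = (\<Sum>i<Suc k. (1 + c) ^ i)"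
    by (simp add: sum.lessThan_Suc_shift sum_distrib_left del: sum.lessThan_Suc)
  finally show ?case .
qed

text \<open>Multiplying the sum by \<open>x - 1\<close> gives \<open>x ^ n = 1\<close>, so the real
  number \<open>x\<close> is 1 or -1; at 1 the sum would be \<open>n\<close>, which is
  positive.\<close>

lemma geometric_sum_eq_0_imp:
  fixes x :: real
  assumes "n > 0" and sum: "(\<Sum>i<n. x ^ i) = 0"
  shows "x = -1"
proof -
  have "x ^ n - 1 = (x - 1) * (\<Sum>i<n. x ^ i)" by (rule power_diff_1_eq)
  then have "x ^ n = 1" using sum by simp
  then have "\<bar>x\<bar> = 1"
    using \<open>n > 0\<close> by (metis abs_1 abs_ge_zero power_abs power_eq_1_iff not_gr_zero real_norm_def)
  moreover have "x \<noteq> 1" using sum \<open>n > 0\<close> by auto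
  ultimately show ?thesis by linarith
qed

lemma square_eq_one_if_fixed_codim_le_1:
  assumes A: "A \<in> carrier_mat d d" and pow: "A ^\<^sub>m n = 1\<^sub>m d" and "n > 0"
    and codim: "fixed_codim d A \<le> 1"
  shows "A * A = 1\<^sub>m d"
proof -
  define N where "N = A - 1\<^sub>m d"
  have N: "N \<in> carrier_mat d d" and A_eq: "A = 1\<^sub>m d + N"
    using A by (auto simp: N_def)
  \<comment> \<open>This bound follows even from truncated subtraction, so the dimension of the
    kernel need not be compared with \<open>d\<close> first.\<close>
  have "d \<le> Suc (kernel_dim N)"
    using codim N by (simp add: fixed_codim_def fixed_space_eq_kernel[OF A] kernel_dim_def N_def)
  then obtain c where c: "N * N = c \<cdot>\<^sub>m N"
    using square_eq_smult_if_corank_le_1[OF N] by blast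
  define s where "s k = (\<Sum>i<k. (1 + c) ^ i)" for k :: nat
  have power: "A ^\<^sub>m k = 1\<^sub>m d + s k \<cdot>\<^sub>m N" for k
    unfolding A_eq s_def by (rule pow_one_add_mat[OF N c])
  \<comment> \<open>By \<open>power\<close> this says that the square of \<open>A\<close> is the
    identity. If \<open>s n = 0\<close>, the ratio is -1 and \<open>s 2 = 1 + (-1) = 0\<close>;
    otherwise \<open>s n\<close> can be cancelled from \<open>A ^\<^sub>m n = 1\<^sub>m d\<close>,
    which leaves \<open>N = 0\<close>.\<close>
  have "s 2 \<cdot>\<^sub>m N = 0\<^sub>m d d"
  proof (cases "s n = 0")
    case True
    then have "1 + c = -1"
      using \<open>n > 0\<close> unfolding s_def by (intro geometric_sum_eq_0_imp)
    then have "s 2 = 0" by (simp add: s_def numeral_2_eq_2)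
    then show ?thesis using N by (auto intro!: eq_matI)
  next
    case False
    have "s n * N $$ (i, j) = 0" if "i < d" "j < d" for i j
    proof -
      have "(1\<^sub>m d + s n \<cdot>\<^sub>m N) $$ (i, j) = 1\<^sub>m d $$ (i, j)"
        using power[of n] pow by simp
      then show ?thesis using that N by simp
    qed
    then show ?thesis using N False by (auto intro!: eq_matI)
  qed
  then have "A ^\<^sub>m 2 = 1\<^sub>m d" using power[of 2] by simp
  then show ?thesis using A by (simp add: numeral_2_eq_2)
qed

section \<open>Lower bound: no faithful representation in codimension at most one\<close>

lemma real_GL_pow:
  assumes "A \<in> carrier_mat d d"
  shows "A [^]\<^bsub>real_GL d\<^esub> (k::nat) = A ^\<^sub>m k"
proof -
  interpret group "real_GL d" by (rule group_real_GL)
  show ?thesis using assms by (induction k) (simp_all add: real_GL_simps)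
qed

text \<open>A faithful \<rho> is an isomorphism onto its image, so generation can be tested in
  \<Gamma> itself. Later arguments then work with residues and only consult \<rho> for
  codimensions.\<close>

lemma has_rep_generated_in_codim_iff:
  assumes "group \<Gamma>" "finite (carrier \<Gamma>)"
  shows "has_rep_generated_in_codim \<Gamma> k \<longleftrightarrow>
    (\<exists>d \<rho>. faithful_real_rep \<Gamma> d \<rho> \<and>
       generate \<Gamma> {x \<in> carrier \<Gamma>. fixed_codim d (\<rho> x) = k} = carrier \<Gamma>)"
proof -
  have "strictly_generated_in_codim d (\<rho> ` carrier \<Gamma>) k \<longleftrightarrow>
      generate \<Gamma> {x \<in> carrier \<Gamma>. fixed_codim d (\<rho> x) = k} = carrier \<Gamma>"
    (is "_ \<longleftrightarrow> generate \<Gamma> ?T = _")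
    if rep: "faithful_real_rep \<Gamma> d \<rho>" for d \<rho>
  proof -
    interpret group_hom \<Gamma> "real_GL d" \<rho>
      using rep assms(1) group_real_GL
      by (simp add: faithful_real_rep_def group_hom_def group_hom_axioms_def)
    have inj: "inj_on \<rho> (carrier \<Gamma>)" using rep by (simp add: faithful_real_rep_def)
    have "{A \<in> \<rho> ` carrier \<Gamma>. fixed_codim d A = k} = \<rho> ` ?T" by auto
    moreover have "generate (real_GL d) (\<rho> ` ?T) = \<rho> ` generate \<Gamma> ?T"
      by (rule generate_img) auto
    moreover have "generate \<Gamma> ?T \<subseteq> carrier \<Gamma>" by (rule G.generate_incl) auto
    ultimately show ?thesis
      using assms(2) img_is_subgroup inj_on_image_eq_iff[OF inj, of "generate \<Gamma> ?T" "carrier \<Gamma>"]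
      by (simp add: strictly_generated_in_codim_def)
  qed
  then show ?thesis unfolding has_rep_generated_in_codim_def by blast
qed

text \<open>In an abelian group squaring is a homomorphism, so the elements with trivial square form
  a subgroup; it contains \<open>T\<close>, hence all that \<open>T\<close> generates.\<close>

lemma (in comm_group) square_eq_one_if_generate:
  assumes "T \<subseteq> carrier G" and "\<And>t. t \<in> T \<Longrightarrow> t \<otimes> t = \<one>" and "x \<in> generate G T"
  shows "x \<otimes> x = \<one>"
  using assms(3)
proof induction
  case (inv t)
  then have "inv t = t" using assms by (auto intro: inv_equality)
  then show ?case using inv assms by simp
next
  case (eng x y)
  then have "x \<in> carrier G" "y \<in> carrier G"
    using generate_in_carrier[OF assms(1)] by auto
  then have "(x \<otimes> y) \<otimes> (x \<otimes> y) = (x \<otimes> x) \<otimes> (y \<otimes> y)" by (simp add: m_ac)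
  then show ?case using eng by simp
qed (use assms in auto)

lemma not_has_rep_generated_in_codim_le_1:
  assumes "n > 2" and "j \<le> 1"
  shows "\<not> has_rep_generated_in_codim (integer_mod_group n) j"
proof
  let ?Z = "integer_mod_group n"
  interpret comm_group ?Z by simp
  assume "has_rep_generated_in_codim ?Z j"
  then obtain d \<rho> where rep: "faithful_real_rep ?Z d \<rho>"
    and gen: "generate ?Z {x \<in> carrier ?Z. fixed_codim d (\<rho> x) = j} = carrier ?Z"
      (is "generate ?Z ?T = _")
    using \<open>n > 2\<close> by (auto simp: has_rep_generated_in_codim_iff carrier_integer_mod_group)
  interpret group_hom ?Z "real_GL d" \<rho>
    using rep group_real_GL
    by (simp add: faithful_real_rep_def group_hom_def group_hom_axioms_def)
  have inj: "inj_on \<rho> (carrier ?Z)" using rep by (simp add: faithful_real_rep_def)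
  have "x \<otimes>\<^bsub>?Z\<^esub> x = \<one>\<^bsub>?Z\<^esub>" if "x \<in> ?T" for x
  proof (rule inj_onD[OF inj])
    have x: "x \<in> carrier ?Z" and codim: "fixed_codim d (\<rho> x) \<le> 1" using that \<open>j \<le> 1\<close> by auto
    have \<rho>x: "\<rho> x \<in> carrier_mat d d" using hom_closed[OF x] by (simp add: real_GL_simps)
    \<comment> \<open>Every residue is killed by \<open>n\<close>, so its image has finite order, as
      the matrix lemma requires.\<close>
    have "\<rho> x ^\<^sub>m n = \<rho> (x [^]\<^bsub>?Z\<^esub> n)" using x \<rho>x by (simp only: hom_nat_pow real_GL_pow)
    also have "\<dots> = 1\<^sub>m d" using hom_one by (simp add: real_GL_simps)
    finally have "\<rho> x * \<rho> x = 1\<^sub>m d"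
      using square_eq_one_if_fixed_codim_le_1[OF \<rho>x _ _ codim, of n] \<open>n > 2\<close> by simp
    then show "\<rho> (x \<otimes>\<^bsub>?Z\<^esub> x) = \<rho> \<one>\<^bsub>?Z\<^esub>"
      using hom_mult[OF x x] hom_one by (simp add: real_GL_simps)
    show "x \<otimes>\<^bsub>?Z\<^esub> x \<in> carrier ?Z"
      using x by (intro monoid.m_closed group.is_monoid group_integer_mod_group)
  qed simp
  \<comment> \<open>The residue 1 gives the contradiction: its double is 2, which is nonzero modulo
    \<open>n\<close> for \<open>n > 2\<close>.\<close>
  moreover have "1 \<in> generate ?Z ?T" using gen \<open>n > 2\<close> by simp
  ultimately have "1 \<otimes>\<^bsub>?Z\<^esub> 1 = \<one>\<^bsub>?Z\<^esub>"
    by (intro square_eq_one_if_generate[where T = ?T and x = 1] subsetI; blast)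
  then show False using \<open>n > 2\<close> by simp
qed

section \<open>Upper bound: rotations of the plane\<close>

definition rotation_mat :: "real \<Rightarrow> real mat" where
  "rotation_mat t = mat 2 2 (\<lambda>(i, j). if i = j then cos t else if i = 0 then - sin t else sin t)"

lemma rotation_mat_carrier [simp]: "rotation_mat t \<in> carrier_mat 2 2"
  by (simp add: rotation_mat_def)

lemma rotation_mat_add: "rotation_mat (s + t) = rotation_mat s * rotation_mat t"
  by (rule eq_matI)
    (auto simp: rotation_mat_def scalar_prod_def less_2_cases_iff cos_add sin_add numeral_2_eq_2)

text \<open>The first column is the point of the unit circle at angle \<open>t\<close>, so it
  determines the angle up to full turns. This yields both faithfulness and the test for the
  identity.\<close>

lemma rotation_mat_eq_iff:
  "rotation_mat s = rotation_mat t \<longleftrightarrow> (\<exists>k::int. s = t + 2 * pi * k)"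
proof -
  have "rotation_mat s = rotation_mat t \<longleftrightarrow> sin s = sin t \<and> cos s = cos t"
  proof
    assume "rotation_mat s = rotation_mat t"
    then have "rotation_mat s $$ (1, 0) = rotation_mat t $$ (1, 0)"
      and "rotation_mat s $$ (0, 0) = rotation_mat t $$ (0, 0)" by simp_all
    then show "sin s = sin t \<and> cos s = cos t" by (simp add: rotation_mat_def)
  qed (auto simp: rotation_mat_def)
  then show ?thesis by (simp add: sin_cos_eq_iff)
qed

lemma rotation_mat_0: "rotation_mat 0 = 1\<^sub>m 2"
  by (rule eq_matI) (auto simp: rotation_mat_def)

lemma rotation_mat_in_real_GL: "rotation_mat t \<in> carrier (real_GL 2)"
proof -
  have "rotation_mat (- t) * rotation_mat t = 1\<^sub>m 2" "rotation_mat t * rotation_mat (- t) = 1\<^sub>m 2"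
    by (simp_all flip: rotation_mat_add rotation_mat_0)
  then show ?thesis by (auto simp: real_GL_simps intro!: bexI[of _ "rotation_mat (- t)"])
qed

lemma fixed_codim_rotation_mat:
  assumes "rotation_mat t \<noteq> 1\<^sub>m 2"
  shows "fixed_codim 2 (rotation_mat t) = 2"
proof -
  let ?N = "rotation_mat t - 1\<^sub>m 2"
  have N: "?N \<in> carrier_mat 2 2" by (simp add: minus_carrier_mat)
  have "cos t \<noteq> 1 \<or> sin t \<noteq> 0"
    using assms rotation_mat_eq_iff[of t 0] sin_cos_eq_iff[of t 0] by (auto simp: rotation_mat_0)
  \<comment> \<open>This number is the determinant of \<open>?N\<close>.\<close>
  then have nz: "(cos t - 1)\<^sup>2 + (sin t)\<^sup>2 \<noteq> 0" by (simp add: sum_power2_eq_zero_iff)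
  have "v = 0\<^sub>v 2" if v: "v \<in> carrier_vec 2" and Nv: "?N *\<^sub>v v = 0\<^sub>v 2" for v
  proof -
    have "(?N *\<^sub>v v) $ 0 = 0" "(?N *\<^sub>v v) $ 1 = 0" using Nv by simp_all
    then have eqs: "(cos t - 1) * v $ 0 - sin t * v $ 1 = 0" "sin t * v $ 0 + (cos t - 1) * v $ 1 = 0"
      using v by (simp_all add: rotation_mat_def scalar_prod_def numeral_2_eq_2)
    \<comment> \<open>Cramer's rule: the two equations are combined by the adjugate of the matrix
      with rows \<open>(a, -b)\<close> and \<open>(b, a)\<close>.\<close>
    have "(a\<^sup>2 + b\<^sup>2) * x = a * (a * x - b * y) + b * (b * x + a * y)"
      and "(a\<^sup>2 + b\<^sup>2) * y = a * (b * x + a * y) - b * (a * x - b * y)" for a b x y :: real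
      by (simp_all add: power2_eq_square algebra_simps)
    from this[where a = "cos t - 1" and b = "sin t" and x = "v $ 0" and y = "v $ 1"]
    have "v $ 0 = 0" "v $ 1 = 0"
      using nz unfolding eqs by auto
    then show ?thesis using v by (auto intro!: eq_vecI simp: less_2_cases_iff)
  qed
  then have "mat_kernel ?N = {0\<^sub>v 2}"
    using N by (auto simp: mat_kernel[OF N])
  \<comment> \<open>The zero space is rewritten as the kernel of the identity so that
    \<open>kernel_one_mat\<close> supplies its dimension.\<close>
  also have "\<dots> = mat_kernel (1\<^sub>m 2)" by (auto simp: mat_kernel_def)
  finally show ?thesis
    by (simp add: fixed_codim_def fixed_space_eq_kernel kernel_one_mat)
qed

lemma has_rep_generated_in_codim_2:
  assumes "n > 1"
  shows "has_rep_generated_in_codim (integer_mod_group n) 2"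
proof -
  let ?Z = "integer_mod_group n"
  define \<rho> where "\<rho> x = rotation_mat (2 * pi * real_of_int x / real n)" for x
  \<comment> \<open>Stated for all integers rather than residues: it gives injectivity on the
    carrier and also lets the reduction modulo \<open>n\<close> in the group operation be dropped
    under \<rho>.\<close>
  have \<rho>_eq_iff: "\<rho> x = \<rho> y \<longleftrightarrow> x mod int n = y mod int n" for x y
  proof -
    have "\<rho> x = \<rho> y \<longleftrightarrow> (\<exists>k::int. x = y + int n * k)"
    proof -
      have "2 * pi * real_of_int x / real n = 2 * pi * real_of_int y / real n + 2 * pi * real_of_int k
          \<longleftrightarrow> x = y + int n * k" for k
      proof -
        have "2 * pi * real_of_int x / real n = 2 * pi * real_of_int y / real n + 2 * pi * real_of_int k
          \<longleftrightarrow> 2 * pi * real_of_int x = 2 * pi * real_of_int (y + int n * k)"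
          using \<open>n > 1\<close> by (auto simp: field_simps)
        also have "\<dots> \<longleftrightarrow> x = y + int n * k"
          using pi_neq_zero by (simp only: mult_cancel_left of_int_eq_iff) auto
        finally show ?thesis .
      qed
      then show ?thesis by (simp add: \<rho>_def rotation_mat_eq_iff)
    qed
    also have "\<dots> \<longleftrightarrow> x mod int n = y mod int n"
      by (auto simp: mod_eq_dvd_iff dvd_def algebra_simps)
    finally show ?thesis .
  qed
  have "\<rho> \<in> hom ?Z (real_GL 2)"
  proof (rule homI)
    fix x y
    have "\<rho> (x \<otimes>\<^bsub>?Z\<^esub> y) = \<rho> (x + y)" by (simp add: \<rho>_eq_iff)
    also have "\<dots> = \<rho> x \<otimes>\<^bsub>real_GL 2\<^esub> \<rho> y"
      by (simp add: \<rho>_def real_GL_simps add_divide_distrib distrib_left flip: rotation_mat_add)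
    finally show "\<rho> (x \<otimes>\<^bsub>?Z\<^esub> y) = \<rho> x \<otimes>\<^bsub>real_GL 2\<^esub> \<rho> y" .
  qed (simp add: \<rho>_def rotation_mat_in_real_GL)
  moreover have "inj_on \<rho> (carrier ?Z)"
    using \<open>n > 1\<close> by (auto intro!: inj_onI simp: \<rho>_eq_iff carrier_integer_mod_group)
  ultimately have rep: "faithful_real_rep ?Z 2 \<rho>" by (simp add: faithful_real_rep_def)
  have "\<rho> 1 \<noteq> \<rho> 0" using \<open>n > 1\<close> by (simp add: \<rho>_eq_iff)
  then have codim: "fixed_codim 2 (\<rho> 1) = 2"
    using fixed_codim_rotation_mat by (simp add: \<rho>_def rotation_mat_0)
  let ?T = "{x \<in> carrier ?Z. fixed_codim 2 (\<rho> x) = 2}"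
  interpret group ?Z by simp
  have one: "1 \<in> carrier ?Z" using \<open>n > 1\<close> by simp
  \<comment> \<open>The residue 1 alone generates, so only the codimension of its image, the
    rotation by \<open>2 * pi / n\<close>, has to be known.\<close>
  have "carrier ?Z \<subseteq> generate ?Z {1}"
  proof
    fix x assume "x \<in> carrier ?Z"
    then have "x = 1 [^]\<^bsub>?Z\<^esub> x"
      using \<open>n > 1\<close> by (auto simp: int_pow_integer_mod_group carrier_integer_mod_group)
    then show "x \<in> generate ?Z {1}" using generate_pow[OF one] by blast
  qed
  also have "\<dots> \<subseteq> generate ?Z ?T" using one codim by (intro mono_generate) auto
  finally have "generate ?Z ?T = carrier ?Z" using generate_incl[of ?T] by auto
  then show ?thesis
    using rep \<open>n > 1\<close> by (auto simp: has_rep_generated_in_codim_iff carrier_integer_mod_group)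
qed

theorem corollary3p2:
  fixes n :: nat
  assumes "n > 2"
  shows "minimally_generated_in_codim (integer_mod_group n) 2"
proof -
  have "2 \<le> j" if "has_rep_generated_in_codim (integer_mod_group n) j" for j
    using not_has_rep_generated_in_codim_le_1[OF assms] that by (metis Suc_1 not_less_eq_eq)
  then show ?thesis
    using assms has_rep_generated_in_codim_2[of n]
    by (simp add: minimally_generated_in_codim_def carrier_integer_mod_group)
qed

end
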